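(* Let $0<\alpha\le1$ and $p_k>1$ for $k=1,\dots,n$. Let $u\ge0$ and $v>0$ be functions that are conformable differentiable of order $\alpha$ a.e. in an open domain $\Omega\subset\mathbb{R}^n$. Define $$\mathcal{R}(u,v)=\sum_{k=1}^n|D^\alpha_{x_k}u|^{p_k}-\sum_{k=1}^nD^\alpha_{x_k}\left(\frac{u^{p_k}}{v^{p_k-1}}\right)|D^\alpha_{x_k}v|^{p_k-2}D^\alpha_{x_k}v,$$ $$\mathcal{L}(u,v)=\sum_{k=1}^n|D^\alpha_{x_k}u|^{p_k}+\sum_{k=1}^n(p_k-1)\frac{u^{p_k}}{v^{p_k}}|D^\alpha_{x_k}v|^{p_k}-\sum_{k=1}^np_k\frac{u^{p_k-1}}{v^{p_k-1}}|D^\alpha_{x_k}v|^{p_k-2}D^\alpha_{x_k}u\,D^\alpha_{x_k}v.$$ Then $\mathcal{R}(u,v)=\mathcal{L}(u,v)\ge0$. Moreover, $\mathcal{L}(u,v)=0$ a.e. in $\Omega$ if and only if $u/v=c$ for a positive constant $c$.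
   Context: For $\alpha\in(0,1]$ and a real function $f$ of $x=(x_1,\dots,x_n)$, the conformable partial derivative is $D^\alpha_{x_k}f(x)=\lim_{\delta\to0}\frac{f(x_1,\dots,x_k+\delta x_k^{1-\alpha},\dots,x_n)-f(x)}{\delta}$; for differentiable $f$ it equals $x_k^{1-\alpha}\,\partial f/\partial x_k$. When $\alpha<1$ all domains are taken in $\{x_1>0,\dots,x_n>0\}$, so that $x_k^{1-\alpha}$ is defined. A function is conformable differentiable of order $\alpha$ at a point if all $D^\alpha_{x_k}f$, $k=1,\dots,n$, exist there. The expression $|t|^{p-2}t$ is understood as $0$ at $t=0$.
   Formalization: The step "L=0 a.e. implies u/v=c>0" fails for functions only differentiable a.e. (step or Cantor-type u, v=1) and for u=0; it is proved assuming u is not identically 0 and u/v is continuous and maps null sets to null sets along every line parallel to an axis. *)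

theory Defs
  imports "HOL-Analysis.Analysis"
begin

(* The weight x_k^(1 - alpha). The case alpha = 1 is separate because then the weight is 1
   everywhere, also at x_k = 0, whereas 0 powr 0 = 0. *)
definition conf_weight :: "real \<Rightarrow> real \<Rightarrow> real" where
  "conf_weight \<alpha> t = (if \<alpha> = 1 then 1 else t powr (1 - \<alpha>))"

definition conf_quotient ::
    "real \<Rightarrow> 'n::finite \<Rightarrow> (real^'n \<Rightarrow> real) \<Rightarrow> real^'n \<Rightarrow> real \<Rightarrow> real" where
  "conf_quotient \<alpha> k f x \<delta> = (f (x + axis k (\<delta> * conf_weight \<alpha> (x $ k))) - f x) / \<delta>"

definition conf_pderiv_exists ::
    "real \<Rightarrow> 'n::finite \<Rightarrow> (real^'n \<Rightarrow> real) \<Rightarrow> real^'n \<Rightarrow> bool" where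
  "conf_pderiv_exists \<alpha> k f x \<longleftrightarrow> (\<exists>l. (conf_quotient \<alpha> k f x \<longlongrightarrow> l) (at 0))"

definition conf_pderiv ::
    "real \<Rightarrow> 'n::finite \<Rightarrow> (real^'n \<Rightarrow> real) \<Rightarrow> real^'n \<Rightarrow> real" where
  "conf_pderiv \<alpha> k f x = Lim (at 0) (conf_quotient \<alpha> k f x)"

definition conf_differentiable_at ::
    "real \<Rightarrow> (real^'n::finite \<Rightarrow> real) \<Rightarrow> real^'n \<Rightarrow> bool" where
  "conf_differentiable_at \<alpha> f x \<longleftrightarrow> (\<forall>k. conf_pderiv_exists \<alpha> k f x)"

(* |t|^(p-2) t is written |t| powr (p - 2) * t; it vanishes at t = 0, also for p < 2. *)

definition picone_R ::
    "real \<Rightarrow> ('n::finite \<Rightarrow> real) \<Rightarrow> (real^'n \<Rightarrow> real) \<Rightarrow> (real^'n \<Rightarrow> real) \<Rightarrow> real^'n \<Rightarrow> real" where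
  "picone_R \<alpha> p u v x =
     (\<Sum>k\<in>UNIV. \<bar>conf_pderiv \<alpha> k u x\<bar> powr p k)
   - (\<Sum>k\<in>UNIV. conf_pderiv \<alpha> k (\<lambda>y. u y powr p k / v y powr (p k - 1)) x
        * (\<bar>conf_pderiv \<alpha> k v x\<bar> powr (p k - 2) * conf_pderiv \<alpha> k v x))"

definition picone_L ::
    "real \<Rightarrow> ('n::finite \<Rightarrow> real) \<Rightarrow> (real^'n \<Rightarrow> real) \<Rightarrow> (real^'n \<Rightarrow> real) \<Rightarrow> real^'n \<Rightarrow> real" where
  "picone_L \<alpha> p u v x =
     (\<Sum>k\<in>UNIV. \<bar>conf_pderiv \<alpha> k u x\<bar> powr p k)
   + (\<Sum>k\<in>UNIV. (p k - 1) * (u x powr p k / v x powr p k) * \<bar>conf_pderiv \<alpha> k v x\<bar> powr p k)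
   - (\<Sum>k\<in>UNIV. p k * (u x powr (p k - 1) / v x powr (p k - 1))
        * \<bar>conf_pderiv \<alpha> k v x\<bar> powr (p k - 2) * conf_pderiv \<alpha> k u x * conf_pderiv \<alpha> k v x)"

(* Continuity and Luzin's condition (N) along every line parallel to a coordinate axis.
   Differentiability almost everywhere alone does not make a function with vanishing derivatives
   constant (step functions, the Cantor function). The condition holds if f is locally absolutely
   continuous in each variable, and also if f has all its partial derivatives at every point. *)
definition luzin_along_axes :: "(real^'n::finite \<Rightarrow> real) \<Rightarrow> (real^'n) set \<Rightarrow> bool" where
  "luzin_along_axes f \<Omega> \<longleftrightarrow> (\<forall>x\<in>\<Omega>. \<forall>k.
     let g = (\<lambda>t. f (x + axis k t)); S = {t. x + axis k t \<in> \<Omega>} in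
       continuous_on S g \<and> (\<forall>N\<subseteq>S. negligible N \<longrightarrow> negligible (g ` N)))"

lemma conf_weight_pos:
  assumes "\<alpha> < 1 \<Longrightarrow> 0 < t" "\<alpha> \<le> 1"
  shows "0 < conf_weight \<alpha> t"
  using assms by (auto simp: conf_weight_def)

lemma conf_pderiv_exists_imp_differentiable:
  fixes f :: "real^'n::finite \<Rightarrow> real"
  assumes "conf_pderiv_exists \<alpha> k f (x + axis k t)" "0 < conf_weight \<alpha> ((x + axis k t) $ k)"
  shows "(\<lambda>s. f (x + axis k s)) differentiable (at t)"
proof -
  define w where "w = conf_weight \<alpha> ((x + axis k t) $ k)"
  have w: "w > 0" using assms(2) by (simp add: w_def)
  obtain l where l: "(conf_quotient \<alpha> k f (x + axis k t) \<longlongrightarrow> l) (at 0)"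
    using assms(1) by (auto simp: conf_pderiv_exists_def)
  have lim0: "filterlim (\<lambda>h. h / w) (at 0) (at 0)"
    unfolding filterlim_at using w
    by (auto intro!: tendsto_eq_intros simp: eventually_at_filter)
  have "((\<lambda>h. conf_quotient \<alpha> k f (x + axis k t) (h / w) / w) \<longlongrightarrow> l / w) (at 0)"
    using filterlim_compose[OF l lim0] w by (intro tendsto_intros) auto
  moreover have "axis k (a + b) = axis k a + axis k b" for a b :: real
    by (simp add: axis_def vec_eq_iff)
  hence "conf_quotient \<alpha> k f (x + axis k t) (h / w) / w = (f (x + axis k (t + h)) - f (x + axis k t)) / h"
    for h
    using w unfolding conf_quotient_def w_def[symmetric] by (simp add: add.assoc)
  ultimately have "((\<lambda>s. f (x + axis k s)) has_field_derivative (l / w)) (at t)"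
    by (simp add: DERIV_def)
  thus ?thesis by (auto simp: real_differentiable_def)
qed

lemma luzin_along_axes_quotient:
  fixes u v :: "real^'n::finite \<Rightarrow> real"
  assumes "\<alpha> \<le> 1" "\<alpha> < 1 \<longrightarrow> \<Omega> \<subseteq> {x. \<forall>k. 0 < x $ k}"
    and "\<And>x. x \<in> \<Omega> \<Longrightarrow> conf_differentiable_at \<alpha> u x"
    and "\<And>x. x \<in> \<Omega> \<Longrightarrow> conf_differentiable_at \<alpha> v x"
    and "\<And>x. x \<in> \<Omega> \<Longrightarrow> 0 < v x"
  shows "luzin_along_axes (\<lambda>x. u x / v x) \<Omega>"
proof -
  have diff: "(\<lambda>t. u (x + axis k t) / v (x + axis k t)) differentiable_on {t. x + axis k t \<in> \<Omega>}"
    for x k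
  proof -
    have "(\<lambda>t. u (x + axis k t) / v (x + axis k t)) differentiable (at t)"
      if t: "x + axis k t \<in> \<Omega>" for t
    proof -
      have w: "0 < conf_weight \<alpha> ((x + axis k t) $ k)"
        using assms(1,2) t by (intro conf_weight_pos) (blast+)
      have "v (x + axis k t) \<noteq> 0" using assms(5)[OF t] by simp
      thus ?thesis
        using assms(3,4)[OF t] w
        by (intro differentiable_divide conf_pderiv_exists_imp_differentiable)
           (auto simp: conf_differentiable_at_def)
    qed
    thus ?thesis by (auto simp: differentiable_on_def intro: differentiable_at_withinI)
  qed
  show ?thesis
    unfolding luzin_along_axes_def Let_def
    using differentiable_imp_continuous_on[OF diff]
      negligible_differentiable_image_negligible[OF order_refl _ differentiable_on_subset[OF diff]]
    by blast
qed

end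

(* With r = u/v and s = r|Dv|, the k-th summand of L is the sum of |Du|^p + (p-1) s^p - p s^(p-1) |Du|,
   the gap between the strictly convex function z^p at |Du| and its tangent at s, and a nonnegative
   multiple of |Du| |Dv| - Du Dv. Hence it is nonnegative and vanishes exactly if Du = r Dv, that is,
   if the partial derivative of u/v is zero.

   It remains to see that a function q on a connected open set, satisfying the Luzin condition along
   axes and with vanishing partial derivatives almost everywhere, is constant. On a line where the
   derivative is zero almost everywhere, q maps intervals to null intervals (Sard on the good points,
   condition (N) on the others). In a box, induct on the number of coordinates: by Fubini, for almost
   every value of the last coordinate q is constant on the slice, and one good line in the last
   direction shows that these constants agree; separate continuity handles the remaining slices. *)
theory Submission
  imports Defs
begin

section \<open>Functions of one variable whose derivative vanishes almost everywhere\<close>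

definition luzin_on :: "(real \<Rightarrow> real) \<Rightarrow> real set \<Rightarrow> bool" where
  "luzin_on g S \<longleftrightarrow> continuous_on S g \<and> (\<forall>N\<subseteq>S. negligible N \<longrightarrow> negligible (g ` N))"

text \<open>Brings a conclusion of \<open>baby_Sard\<close>, which concerns \<open>real^1\<close>,
  back to \<open>real\<close>. Null sets are characterised by the integral of their indicator, and
  that integral can be transported along \<open>vec\<close>.\<close>

lemma negligible_image_vec1_D:
  fixes S :: "real set"
  assumes "negligible (vec ` S :: (real^1) set)"
  shows "negligible S"
proof -
  have inj: "inj (vec :: real \<Rightarrow> real^1)"
    by (metis injI vec_component)
  have "(indicat_real (vec ` S :: (real^1) set) has_integral 0) UNIV"
    using assms by (simp add: negligible_UNIV)
  from has_integral_vec1_I[OF this]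
  have "(indicat_real (vec ` S :: (real^1) set) \<circ> vec has_integral 0) (range (\<lambda>x::real^1. x $ 1))" .
  moreover have "range (\<lambda>x::real^1. x $ 1) = UNIV"
    by (metis surjI vec_component)
  moreover have "indicat_real (vec ` S :: (real^1) set) \<circ> vec = indicat_real S"
    using inj by (auto simp: fun_eq_iff indicator_def inj_image_mem_iff)
  ultimately show ?thesis by (simp add: negligible_UNIV)
qed

text \<open>Sard's theorem in dimension one: lifted to \<open>real^1\<close>, the derivative on
  \<open>S\<close> is the zero matrix, of rank 0 < 1.\<close>

lemma negligible_image_deriv_zero:
  fixes g :: "real \<Rightarrow> real"
  assumes "\<And>t. t \<in> S \<Longrightarrow> (g has_real_derivative 0) (at t)"
  shows "negligible (g ` S)"
proof (rule negligible_image_vec1_D)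
  let ?G = "\<lambda>x::real^1. vec (g (x $ 1)) :: real^1"
  have "negligible (?G ` (vec ` S :: (real^1) set))"
  proof (rule baby_Sard)
    fix x :: "real^1" assume "x \<in> vec ` S"
    then obtain t where t: "t \<in> S" "x = vec t" by auto
    \<comment> \<open>The zero map is written as multiplication by a function value at
      \<open>t\<close> to match the premise of \<open>has_derivative_vector_1\<close>.\<close>
    have "(g has_derivative (\<lambda>h. h * (\<lambda>_. 0) t)) (at t within S)"
      using assms[OF t(1)] has_derivative_at_withinI[of g "\<lambda>_. 0" t S]
      by (simp add: has_field_derivative_def lambda_zero)
    from has_derivative_vector_1[OF this]
    show "(?G has_derivative (\<lambda>_. 0)) (at x within vec ` S)" using t(2) by (simp add: scaleR_zero_left[abs_def])
    show "rank (matrix (\<lambda>_::real^1. 0::real^1)) < CARD(1)"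
      by (simp add: matrix_def zero_vec_def[symmetric])
  qed simp
  moreover have "?G ` (vec ` S :: (real^1) set) = vec ` (g ` S)" by (simp add: image_image)
  ultimately show "negligible (vec ` (g ` S) :: (real^1) set)" by simp
qed

text \<open>The exceptional set need not be Borel. One direction covers it by a Borel null set, the
  other passes through the completion, which has the same almost-everywhere statements.\<close>

lemma AE_lborel_iff_negligible: "(AE x in lborel. P x) \<longleftrightarrow> negligible {x. \<not> P x}"
proof
  assume "AE x in lborel. P x"
  then obtain N where "{x. \<not> P x} \<subseteq> N" "N \<in> null_sets lborel"
    by (auto simp: eventually_ae_filter)
  thus "negligible {x. \<not> P x}"
    by (metis negligible_iff_null_sets negligible_subset null_sets_completionI)
next
  assume "negligible {x. \<not> P x}"
  hence "{x. \<not> P x} \<in> null_sets lebesgue" by (simp add: negligible_iff_null_sets)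
  from AE_not_in[OF this] show "AE x in lborel. P x" by (simp add: AE_completion_iff)
qed

text \<open>The image of \<open>S\<close> is connected and null, and two distinct values would force
  it to contain a nondegenerate interval.\<close>

lemma luzin_constant:
  assumes "connected S" "luzin_on g S"
    and ae: "AE t in lborel. t \<in> S \<longrightarrow> (g has_real_derivative 0) (at t)"
    and "s \<in> S" "t \<in> S"
  shows "g s = g t"
proof -
  define Z where "Z = {t \<in> S. (g has_real_derivative 0) (at t)}"
  have "negligible (S - Z)"
    using ae unfolding AE_lborel_iff_negligible by (rule negligible_subset) (auto simp: Z_def)
  \<comment> \<open>Condition (N) enters here: a merely continuous function, such as the Cantor
    function, can map a null set onto an interval.\<close>
  hence "negligible (g ` (S - Z))" using assms(2) by (auto simp: luzin_on_def)
  moreover have "negligible (g ` Z)" by (rule negligible_image_deriv_zero) (simp add: Z_def)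
  moreover have "g ` S = g ` Z \<union> g ` (S - Z)" by (auto simp: Z_def)
  ultimately have neg: "negligible (g ` S)" by simp
  have conn: "connected (g ` S)"
    using assms(1,2) by (auto simp: luzin_on_def intro: connected_continuous_image)
  have "\<not> g a < g b" if "a \<in> S" "b \<in> S" for a b
  proof
    assume "g a < g b"
    moreover have "{g a..g b} \<subseteq> g ` S"
      using connected_contains_Icc[OF conn] that by simp
    ultimately show False
      using negligible_subset[OF neg] negligible_interval(1)[of "g a" "g b"] by auto
  qed
  from this[of s t] this[of t s] assms(4,5) show ?thesis by simp
qed

section \<open>Constancy in several variables, by Fubini and connectedness\<close>

text \<open>The points of \<open>S\<close> with a value other than \<open>c\<close> form a set that
  is both open and null, hence empty.\<close>

lemma continuous_AE_eq_imp_eq: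
  fixes g :: "'a::euclidean_space \<Rightarrow> real"
  assumes "open S" "continuous_on S g" "AE y in lborel. y \<in> S \<longrightarrow> g y = c" "y \<in> S"
  shows "g y = c"
proof -
  have "open (S \<inter> g -` (- {c}))"
    using assms(1,2) by (intro continuous_open_preimage) auto
  moreover have "negligible (S \<inter> g -` (- {c}))"
    using assms(3) unfolding AE_lborel_iff_negligible by (rule negligible_subset) auto
  ultimately show ?thesis using open_not_negligible assms(4) by blast
qed

text \<open>Fubini for almost-everywhere statements. \<open>P\<close> need not be measurable, so the
  indicator of a measurable null set \<open>N\<close> covering the exceptions is integrated, once in
  each order; the induction on coordinates uses both orders.\<close>

lemma (in product_sigma_finite) AE_PiM_insertD:
  assumes [simp]: "finite I" "i \<notin> I" and ae: "AE x in Pi\<^sub>M (insert i I) M. P x"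
  shows "AE y in M i. AE x in Pi\<^sub>M I M. P (x(i := y))"
    and "AE x in Pi\<^sub>M I M. AE y in M i. P (x(i := y))"
proof -
  interpret I: finite_product_sigma_finite M I by standard simp
  interpret sigma_finite_measure "Pi\<^sub>M I M" by (rule sigma_finite) simp
  interpret i: sigma_finite_measure "M i" by (rule sigma_finite_measures)
  obtain N where N: "N \<in> null_sets (Pi\<^sub>M (insert i I) M)"
      "{x \<in> space (Pi\<^sub>M (insert i I) M). \<not> P x} \<subseteq> N"
    using ae by (auto simp: eventually_ae_filter)
  have [measurable]: "N \<in> sets (Pi\<^sub>M (insert i I) M)" using N(1) by auto
  have zero: "(\<integral>\<^sup>+ x. indicator N x \<partial>Pi\<^sub>M (insert i I) M) = 0" using null_setsD1[OF N(1)] by simp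
  have P: "P (x(i := y))" if "x \<in> space (Pi\<^sub>M I M)" "y \<in> space (M i)" "x(i := y) \<notin> N" for x y
  proof -
    have "x(i := y) \<in> space (Pi\<^sub>M (insert i I) M)"
      using that by (auto simp: space_PiM intro!: PiE_fun_upd)
    thus ?thesis using N(2) that by auto
  qed
  have "(\<integral>\<^sup>+ y. \<integral>\<^sup>+ x. indicator N (x(i := y)) \<partial>Pi\<^sub>M I M \<partial>M i) = 0"
    using zero by (subst (asm) product_nn_integral_insert_rev) auto
  hence "AE y in M i. (\<integral>\<^sup>+ x. indicator N (x(i := y)) \<partial>Pi\<^sub>M I M) = 0"
    by (subst (asm) nn_integral_0_iff_AE) measurable
  thus "AE y in M i. AE x in Pi\<^sub>M I M. P (x(i := y))"
    using AE_space
  proof eventually_elim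
    case (elim y)
    note [measurable] = elim(2)
    from elim(1) have "AE x in Pi\<^sub>M I M. indicator N (x(i := y)) = (0::ennreal)"
      by (subst (asm) nn_integral_0_iff_AE) measurable
    thus "AE x in Pi\<^sub>M I M. P (x(i := y))"
      by (rule AE_mp) (use P elim(2) in \<open>auto simp: indicator_def split: if_splits\<close>)
  qed
  have "(\<integral>\<^sup>+ x. \<integral>\<^sup>+ y. indicator N (x(i := y)) \<partial>M i \<partial>Pi\<^sub>M I M) = 0"
    using zero by (subst (asm) product_nn_integral_insert) auto
  hence "AE x in Pi\<^sub>M I M. (\<integral>\<^sup>+ y. indicator N (x(i := y)) \<partial>M i) = 0"
    by (subst (asm) nn_integral_0_iff_AE) measurable
  thus "AE x in Pi\<^sub>M I M. AE y in M i. P (x(i := y))"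
    using AE_space
  proof eventually_elim
    case (elim x)
    note [measurable] = elim(2)
    from elim(1) have "AE y in M i. indicator N (x(i := y)) = (0::ennreal)"
      by (subst (asm) nn_integral_0_iff_AE) measurable
    thus "AE y in M i. P (x(i := y))"
      by (rule AE_mp) (use P elim(2) in \<open>auto simp: indicator_def split: if_splits\<close>)
  qed
qed

text \<open>Stated on extensional functions because the dimension must vary for the induction.
  \<open>f\<close> is generalised, since the induction hypothesis is applied to slices of
  \<open>f\<close>.\<close>

lemma luzin_constant_PiE:
  fixes S :: "'i \<Rightarrow> real set" and f :: "('i \<Rightarrow> real) \<Rightarrow> real"
  assumes "finite I" and S: "\<And>i. i \<in> I \<Longrightarrow> open (S i) \<and> connected (S i) \<and> S i \<noteq> {}"
    and "\<And>x i. x \<in> Pi\<^sub>E I S \<Longrightarrow> i \<in> I \<Longrightarrow> luzin_on (\<lambda>t. f (x(i := t))) (S i)"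
    and "AE x in Pi\<^sub>M I (\<lambda>_. lborel). x \<in> Pi\<^sub>E I S \<longrightarrow>
           (\<forall>i\<in>I. ((\<lambda>t. f (x(i := t))) has_real_derivative 0) (at (x i)))"
    and "x \<in> Pi\<^sub>E I S" "y \<in> Pi\<^sub>E I S"
  shows "f x = f y"
  using assms
proof (induction I arbitrary: f x y rule: finite_induct)
  case empty
  thus ?case by simp
next
  case (insert i J)
  interpret product_sigma_finite "\<lambda>_::'i. lborel :: real measure"
    by standard
  note S = insert.prems(1) and luzin = insert.prems(2) and ae = insert.prems(3)
  let ?D = "\<lambda>x k. ((\<lambda>t. f (x(k := t))) has_real_derivative 0) (at (x k))"
  have upd: "x(i := y) \<in> Pi\<^sub>E (insert i J) S" if "x \<in> Pi\<^sub>E J S" "y \<in> S i" for x y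
    using that by (intro PiE_fun_upd)
  note ae' = AE_PiM_insertD[OF insert.hyps ae]
  \<comment> \<open>Positive measure ensures that a property true almost everywhere holds at some
    point of the box; this yields the base point \<open>x0\<close>.\<close>
  have Jpos: "emeasure (Pi\<^sub>M J (\<lambda>_. lborel)) (Pi\<^sub>E J S) \<noteq> 0"
  proof -
    have "emeasure lborel (S k) \<noteq> 0" if "k \<in> J" for k
    proof
      assume "emeasure lborel (S k) = 0"
      hence "negligible (S k)"
        using S[of k] that by (subst negligible_iff_emeasure0) (auto intro: lborelD)
      thus False using open_not_negligible S[of k] that by blast
    qed
    thus ?thesis
      using insert.hyps S by (subst emeasure_PiM) (auto simp: prod_zero_iff)
  qed
  have "AE x in Pi\<^sub>M J (\<lambda>_. lborel). AE y in lborel. x(i := y) \<in> Pi\<^sub>E (insert i J) S \<longrightarrow>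
          ?D (x(i := y)) i"
    using ae'(2)
  proof eventually_elim
    case (elim x)
    thus ?case by eventually_elim blast
  qed
  moreover have sJ: "Pi\<^sub>E J S \<in> sets (Pi\<^sub>M J (\<lambda>_. lborel))"
    using insert.hyps S by (intro sets_PiM_I_finite) auto
  moreover have "\<not> (AE x in Pi\<^sub>M J (\<lambda>_. lborel). x \<notin> Pi\<^sub>E J S)"
    using Jpos AE_iff_null_sets[OF sJ] by auto
  \<comment> \<open>The line through \<open>x0\<close> in direction \<open>i\<close> is good at
    almost all of its points, so \<open>f\<close> has one value \<open>c\<close> along it.\<close>
  ultimately obtain x0 where x0: "x0 \<in> Pi\<^sub>E J S"
      "AE y in lborel. x0(i := y) \<in> Pi\<^sub>E (insert i J) S \<longrightarrow> ?D (x0(i := y)) i"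
    by (metis (mono_tags, lifting) AE_mp AE_I2)
  have "\<exists>c. \<forall>y\<in>S i. f (x0(i := y)) = c"
  proof -
    have "luzin_on (\<lambda>y. f (x0(i := y))) (S i)"
    proof -
      obtain y where "y \<in> S i" using S[of i] by auto
      from luzin[OF upd[OF x0(1) this] insertI1] show ?thesis by (simp only: fun_upd_upd)
    qed
    moreover have "AE y in lborel. y \<in> S i \<longrightarrow> ((\<lambda>y. f (x0(i := y))) has_real_derivative 0) (at y)"
      using x0(2)
    proof eventually_elim
      case (elim y)
      show ?case
      proof
        assume "y \<in> S i"
        from elim[rule_format, OF upd[OF x0(1) this]]
        show "((\<lambda>y. f (x0(i := y))) has_real_derivative 0) (at y)"
          by (simp only: fun_upd_upd fun_upd_same)
      qed
    qed
    ultimately have "f (x0(i := s)) = f (x0(i := t))" if "s \<in> S i" "t \<in> S i" for s t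
      using luzin_constant[of "S i" "\<lambda>y. f (x0(i := y))"] S that by blast
    thus ?thesis by blast
  qed
  then obtain c where c: "\<And>y. y \<in> S i \<Longrightarrow> f (x0(i := y)) = c" by blast
  \<comment> \<open>For almost every \<open>y\<close> the induction hypothesis makes the slice at
    height \<open>y\<close> constant. Each such slice meets the good line through \<open>x0\<close>,
    so its constant is \<open>c\<close>.\<close>
  have slice: "AE y in lborel. y \<in> S i \<longrightarrow> (\<forall>x\<in>Pi\<^sub>E J S. f (x(i := y)) = c)"
    using ae'(1)
  proof (rule AE_mp, intro AE_I2 impI ballI)
    fix y x assume y: "y \<in> S i" and x: "x \<in> Pi\<^sub>E J S"
      and ae_y: "AE x in Pi\<^sub>M J (\<lambda>_. lborel). x(i := y) \<in> Pi\<^sub>E (insert i J) S \<longrightarrow>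
            (\<forall>k\<in>insert i J. ?D (x(i := y)) k)"
    \<comment> \<open>Commuting the two updates turns conditions on \<open>f\<close> along axis
      \<open>k\<close> into conditions on the slice.\<close>
    have tw: "(\<lambda>t. f ((x(k := t))(i := y))) = (\<lambda>t. f ((x(i := y))(k := t)))" if "k \<in> J" for x k
      using insert.hyps(2) that by (metis fun_upd_twist)
    have "f (x(i := y)) = f (x0(i := y))"
    proof (rule insert.IH[of "\<lambda>x. f (x(i := y))"])
      show "luzin_on (\<lambda>t. f ((z(k := t))(i := y))) (S k)" if "z \<in> Pi\<^sub>E J S" "k \<in> J" for z k
        using luzin[OF upd[OF that(1) y], of k] that(2) by (simp only: tw insert_iff simp_thms)
      show "AE x in Pi\<^sub>M J (\<lambda>_. lborel). x \<in> Pi\<^sub>E J S \<longrightarrow>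
          (\<forall>k\<in>J. ((\<lambda>t. f ((x(k := t))(i := y))) has_real_derivative 0) (at (x k)))"
        using ae_y
      proof (rule AE_mp, intro AE_I2 impI ballI)
        fix z k assume "z \<in> Pi\<^sub>E J S" "k \<in> J" and
          "z(i := y) \<in> Pi\<^sub>E (insert i J) S \<longrightarrow> (\<forall>k\<in>insert i J. ?D (z(i := y)) k)"
        hence "?D (z(i := y)) k" using upd y by blast
        moreover have "k \<noteq> i" using \<open>k \<in> J\<close> insert.hyps by auto
        ultimately show "((\<lambda>t. f ((z(k := t))(i := y))) has_real_derivative 0) (at (z k))"
          by (simp only: tw[OF \<open>k \<in> J\<close>] fun_upd_other not_False_eq_True simp_thms)
      qed
    qed (use S x x0 in auto)
    thus "f (x(i := y)) = c" using c[OF y] by simp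
  qed
  have const: "f z = c" if z: "z \<in> Pi\<^sub>E (insert i J) S" for z
  proof -
    \<comment> \<open>Forgetting coordinate \<open>i\<close> gives a member of the extensional
      \<open>J\<close>-box. Continuity along the line through it in direction \<open>i\<close> then
      covers the null set of exceptional heights.\<close>
    let ?z = "restrict z J"
    have zJ: "?z \<in> Pi\<^sub>E J S" "z i \<in> S i" using z by (auto simp: PiE_iff)
    have eq: "?z(i := z i) = z" using z insert.hyps by (auto simp: fun_eq_iff PiE_iff extensional_def)
    have "continuous_on (S i) (\<lambda>y. f (?z(i := y)))"
      using luzin[OF upd[OF zJ] insertI1] unfolding luzin_on_def fun_upd_upd by (rule conjunct1)
    moreover have "AE y in lborel. y \<in> S i \<longrightarrow> f (?z(i := y)) = c"
      using slice by (rule AE_mp) (use zJ in auto)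
    ultimately have "f (?z(i := z i)) = c"
      using continuous_AE_eq_imp_eq[of "S i" "\<lambda>y. f (?z(i := y))"] S zJ(2) by blast
    thus ?thesis by (simp add: eq)
  qed
  show ?case using insert.prems(4,5) const by simp
qed

text \<open>Transfers the product-space result through the coordinate map \<open>V\<close>, under
  which a product of open intervals corresponds to the box.\<close>

lemma luzin_constant_box:
  fixes g :: "'a::euclidean_space \<Rightarrow> real"
  assumes sub: "box l r \<subseteq> \<Omega>"
    and luzin: "\<And>x b. x \<in> \<Omega> \<Longrightarrow> b \<in> Basis \<Longrightarrow> luzin_on (\<lambda>t. g (x + t *\<^sub>R b)) {t. x + t *\<^sub>R b \<in> \<Omega>}"
    and ae: "AE x in lborel. x \<in> \<Omega> \<longrightarrow> (\<forall>b\<in>Basis. ((\<lambda>t. g (x + t *\<^sub>R b)) has_real_derivative 0) (at 0))"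
    and xy: "x \<in> box l r" "y \<in> box l r"
  shows "g x = g y"
proof -
  define V where "V f = (\<Sum>b\<in>Basis. f b *\<^sub>R b)" for f :: "'a \<Rightarrow> real"
  define S where "S b = {l \<bullet> b<..<r \<bullet> b}" for b
  have V_inner: "V f \<bullet> b = f b" if "b \<in> Basis" for f b
    using that by (simp add: V_def)
  have V_box: "V f \<in> box l r \<longleftrightarrow> (\<forall>b\<in>Basis. f b \<in> S b)" for f
    by (auto simp: mem_box V_inner S_def)
  have V_repr: "V (restrict (\<lambda>b. z \<bullet> b) Basis) = z" for z
    unfolding V_def by (subst euclidean_representation[symmetric, of z]) (rule sum.cong, auto)
  \<comment> \<open>Setting coordinate \<open>b\<close> to \<open>t\<close> is a displacement by
    \<open>t - f b\<close>. Both the Luzin condition and the derivative are therefore transferred by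
    a translation of the parameter.\<close>
  have V_upd: "V (f(b := t)) = V f + (t - f b) *\<^sub>R b" if "b \<in> Basis" for f b t
  proof (rule euclidean_eqI)
    fix c :: 'a assume "c \<in> Basis"
    thus "V (f(b := t)) \<bullet> c = (V f + (t - f b) *\<^sub>R b) \<bullet> c"
      using that by (auto simp: V_inner inner_add_left inner_Basis)
  qed
  have mV: "V \<in> Pi\<^sub>M Basis (\<lambda>_. lborel) \<rightarrow>\<^sub>M borel"
    unfolding V_def by measurable
  \<comment> \<open>Lebesgue-Borel measure is the image of the product measure under
    \<open>V\<close>, so the exceptional set pulls back to a null set.\<close>
  have "AE x in distr (Pi\<^sub>M Basis (\<lambda>_. lborel)) borel V. x \<in> \<Omega> \<longrightarrow>
      (\<forall>b\<in>Basis. ((\<lambda>t. g (x + t *\<^sub>R b)) has_real_derivative 0) (at 0))"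
    using ae unfolding V_def by (subst (asm) lborel_eq)
  note ae_V = AE_distrD[OF mV this]
  have "g (V (restrict (\<lambda>b. x \<bullet> b) Basis)) = g (V (restrict (\<lambda>b. y \<bullet> b) Basis))"
  proof (rule luzin_constant_PiE[of Basis S "\<lambda>f. g (V f)"])
    show "open (S b) \<and> connected (S b) \<and> S b \<noteq> {}" if "b \<in> Basis" for b
      using xy that by (fastforce simp: S_def mem_box)
    show "luzin_on (\<lambda>t. g (V (f(b := t)))) (S b)" if f: "f \<in> Pi\<^sub>E Basis S" and b: "b \<in> Basis" for f b
    proof -
      have in_\<Omega>: "V f + (t - f b) *\<^sub>R b \<in> \<Omega>" if "t \<in> S b" for t
      proof -
        have "V (f(b := t)) \<in> box l r" using that f unfolding V_box by (auto simp: PiE_iff)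
        thus ?thesis using sub V_upd[OF b] by auto
      qed
      have "f b \<in> S b" using f b by auto
      from in_\<Omega>[OF this] have "V f \<in> \<Omega>" by simp
      note L = luzin[OF this b, unfolded luzin_on_def]
      have "continuous_on (S b) ((\<lambda>t. g (V f + t *\<^sub>R b)) \<circ> (\<lambda>t. t - f b))"
        by (rule continuous_on_compose)
           (use in_\<Omega> in \<open>auto intro!: continuous_intros continuous_on_subset[OF conjunct1[OF L]]\<close>)
      moreover have "negligible ((\<lambda>t. g (V f + (t - f b) *\<^sub>R b)) ` N)"
        if "N \<subseteq> S b" "negligible N" for N
      proof -
        have "negligible ((+) (- f b) ` N)" using that(2) by (rule negligible_translation)
        moreover have "(+) (- f b) ` N \<subseteq> {t. V f + t *\<^sub>R b \<in> \<Omega>}"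
          using that(1) in_\<Omega> by (auto simp: algebra_simps)
        ultimately have "negligible ((\<lambda>t. g (V f + t *\<^sub>R b)) ` (+) (- f b) ` N)"
          using L by blast
        thus ?thesis by (simp add: image_image)
      qed
      ultimately show ?thesis by (auto simp: luzin_on_def V_upd[OF b] o_def)
    qed
    show "AE f in Pi\<^sub>M Basis (\<lambda>_. lborel). f \<in> Pi\<^sub>E Basis S \<longrightarrow>
        (\<forall>b\<in>Basis. ((\<lambda>t. g (V (f(b := t)))) has_real_derivative 0) (at (f b)))"
      using ae_V
    proof (rule AE_mp, intro AE_I2 impI ballI)
      fix f b assume f: "f \<in> Pi\<^sub>E Basis S" and b: "b \<in> (Basis :: 'a set)" and
        D: "V f \<in> \<Omega> \<longrightarrow> (\<forall>b\<in>Basis. ((\<lambda>t. g (V f + t *\<^sub>R b)) has_real_derivative 0) (at 0))"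
      have "V f \<in> box l r" using f unfolding V_box by auto
      hence "((\<lambda>t. g (V f + t *\<^sub>R b)) has_real_derivative 0) (at (f b + - f b))"
        using D b sub by auto
      hence "((\<lambda>t. g (V f + (t + - f b) *\<^sub>R b)) has_real_derivative 0) (at (f b))"
        unfolding DERIV_shift by (simp add: o_def)
      thus "((\<lambda>t. g (V (f(b := t)))) has_real_derivative 0) (at (f b))"
        by (simp add: V_upd[OF b])
    qed
  qed (use xy in \<open>auto simp: S_def mem_box\<close>)
  thus ?thesis by (simp add: V_repr)
qed

text \<open>Every point has a box around it inside \<Omega>, so \<open>g\<close> is locally
  constant, and connectedness does the rest.\<close>

lemma luzin_constant_open_connected:
  fixes g :: "'a::euclidean_space \<Rightarrow> real"
  assumes "open \<Omega>" "connected \<Omega>"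
    and luzin: "\<And>x b. x \<in> \<Omega> \<Longrightarrow> b \<in> Basis \<Longrightarrow> luzin_on (\<lambda>t. g (x + t *\<^sub>R b)) {t. x + t *\<^sub>R b \<in> \<Omega>}"
    and ae: "AE x in lborel. x \<in> \<Omega> \<longrightarrow> (\<forall>b\<in>Basis. ((\<lambda>t. g (x + t *\<^sub>R b)) has_real_derivative 0) (at 0))"
    and "x \<in> \<Omega>" "y \<in> \<Omega>"
  shows "g x = g y"
proof (rule connected_local_const[OF assms(2,5,6)], intro ballI)
  fix a assume "a \<in> \<Omega>"
  then obtain l r where lr: "box l r \<subseteq> \<Omega>" "a \<in> box l r"
    using open_contains_box[OF assms(1)] by metis
  have "eventually (\<lambda>b. b \<in> box l r) (at a within \<Omega>)"
    using lr(2) by (meson eventually_at_topological open_box)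
  thus "eventually (\<lambda>b. g a = g b) (at a within \<Omega>)"
    by eventually_elim (rule luzin_constant_box[OF lr(1) luzin ae lr(2)])
qed

section \<open>The scalar inequality behind the Picone identity\<close>

text \<open>Strict convexity of z^p, read off from the mean value theorem and the strict growth of
  z^(p-1).\<close>

lemma powr_tangent_line:
  fixes s t p :: real
  assumes "1 < p" "0 \<le> s" "0 \<le> t"
  shows "p * s powr (p - 1) * t \<le> t powr p + (p - 1) * s powr p"
    and "t powr p + (p - 1) * s powr p = p * s powr (p - 1) * t \<longleftrightarrow> t = s"
proof -
  have strict: "p * s powr (p - 1) * t < t powr p + (p - 1) * s powr p" if "t \<noteq> s"
  proof -
    have deriv: "((\<lambda>z. z powr p) has_real_derivative p * z powr (p - 1)) (at z)" if "z > 0" for z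
      using that by (auto intro!: derivative_eq_intros)
    \<comment> \<open>Continuity is needed down to 0, where \<open>deriv\<close> says nothing; the
      mean value theorem then also applies when \<open>s\<close> or \<open>t\<close> is 0.\<close>
    have cont: "continuous_on {l..r} (\<lambda>z. z powr p)" if "0 \<le> l" for l r :: real
      using assms(1) that by (intro continuous_on_powr') (auto intro!: continuous_intros)
    have base: "s powr p = s powr (p - 1) * s"
      using assms by (cases "s = 0") (auto simp: powr_mult_base mult.commute)
    have "p * s powr (p - 1) * (t - s) < t powr p - s powr p"
    proof (cases "s < t")
      case True
      obtain z where z: "s < z" "z < t" "t powr p - s powr p = p * z powr (p - 1) * (t - s)"
        using mvt[OF True cont[OF assms(2)], of "\<lambda>z h. p * z powr (p - 1) * h"] deriv assms(2)
        by (auto simp: has_field_derivative_def)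
      have "s powr (p - 1) < z powr (p - 1)"
        using z(1) assms by (intro powr_less_mono2) auto
      thus ?thesis using z(3) True assms(1) by simp
    next
      case False
      hence "t < s" using that by simp
      then obtain z where z: "t < z" "z < s" "s powr p - t powr p = p * z powr (p - 1) * (s - t)"
        using mvt[OF _ cont[OF assms(3)], of s "\<lambda>z h. p * z powr (p - 1) * h"] deriv assms(3)
        by (auto simp: has_field_derivative_def)
      have "z powr (p - 1) < s powr (p - 1)"
        using z assms by (intro powr_less_mono2) auto
      hence "p * z powr (p - 1) * (s - t) < p * s powr (p - 1) * (s - t)"
        using \<open>t < s\<close> assms(1) by simp
      thus ?thesis using z(3) by (simp add: algebra_simps)
    qed
    thus ?thesis using base by (simp add: algebra_simps)
  qed
  have eq: "s powr p + (p - 1) * s powr p = p * s powr (p - 1) * s"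
    using assms by (cases "s = 0") (auto simp: powr_mult_base algebra_simps)
  show "p * s powr (p - 1) * t \<le> t powr p + (p - 1) * s powr p"
    and "t powr p + (p - 1) * s powr p = p * s powr (p - 1) * t \<longleftrightarrow> t = s"
    using strict eq by (cases "t = s"; force)+
qed

text \<open>At \<open>b = 0\<close> all powers are 0, so the exponents are unrestricted. The second
  identity is the first used at \<open>p\<close> and at \<open>p + 1\<close>.\<close>

lemma abs_powr_diff_two:
  fixes b p :: real
  shows "\<bar>b\<bar> powr (p - 2) * \<bar>b\<bar> = \<bar>b\<bar> powr (p - 1)"
    and "\<bar>b\<bar> powr (p - 2) * b * b = \<bar>b\<bar> powr p"
proof -
  show *: "\<bar>b\<bar> powr (q - 2) * \<bar>b\<bar> = \<bar>b\<bar> powr (q - 1)" for q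
    by (cases "b = 0") (auto simp: powr_mult_base mult.commute)
  have "\<bar>b\<bar> powr (p - 2) * \<bar>b\<bar> * \<bar>b\<bar> = \<bar>b\<bar> powr p"
    using *[of p] *[of "p + 1"] by simp
  thus "\<bar>b\<bar> powr (p - 2) * b * b = \<bar>b\<bar> powr p" by (simp add: mult.assoc)
qed

text \<open>One summand of \<open>picone_L\<close>, with \<open>r\<close> for u/v and
  \<open>a\<close>, \<open>b\<close> for the conformable derivatives of u and v.\<close>

definition picone_term :: "real \<Rightarrow> real \<Rightarrow> real \<Rightarrow> real \<Rightarrow> real" where
  "picone_term p r a b = \<bar>a\<bar> powr p + (p - 1) * r powr p * \<bar>b\<bar> powr p
     - p * r powr (p - 1) * \<bar>b\<bar> powr (p - 2) * a * b"

lemma picone_term: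
  assumes "1 < p" "0 \<le> r"
  shows picone_term_nonneg: "0 \<le> picone_term p r a b"
    and picone_term_eq_0_iff: "picone_term p r a b = 0 \<longleftrightarrow> a = r * b"
proof -
  let ?s = "r * \<bar>b\<bar>"
  \<comment> \<open>\<open>X\<close> is the convexity gap between |a| and its comparison point r|b|;
    \<open>Y\<close> measures the failure of \<open>a\<close> and \<open>b\<close> to have equal
    signs.\<close>
  define X where "X = \<bar>a\<bar> powr p + (p - 1) * ?s powr p - p * ?s powr (p - 1) * \<bar>a\<bar>"
  define Y where "Y = p * r powr (p - 1) * \<bar>b\<bar> powr (p - 2) * (\<bar>a\<bar> * \<bar>b\<bar> - a * b)"
  have split: "picone_term p r a b = X + Y"
    using assms unfolding picone_term_def X_def Y_def
    by (simp add: powr_mult algebra_simps flip: abs_powr_diff_two(1)[of b p])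
  have X: "0 \<le> X" "X = 0 \<longleftrightarrow> \<bar>a\<bar> = ?s"
    using powr_tangent_line[of p ?s "\<bar>a\<bar>"] assms by (auto simp: X_def)
  have Y: "0 \<le> Y"
    using assms unfolding Y_def by (intro mult_nonneg_nonneg) (auto simp flip: abs_mult)
  show "0 \<le> picone_term p r a b" using X Y split by simp
  show "picone_term p r a b = 0 \<longleftrightarrow> a = r * b"
  proof
    assume "picone_term p r a b = 0"
    hence "X = 0" "Y = 0" using X Y split by auto
    hence a: "\<bar>a\<bar> = ?s" using X by simp
    show "a = r * b"
    \<comment> \<open>If r|b| = 0, the coefficient in \<open>Y\<close> vanishes and gives no sign
      information, but then both \<open>a\<close> and \<open>r * b\<close> are 0. Otherwise
      \<open>Y = 0\<close> fixes the sign.\<close>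
    proof (cases "?s = 0")
      case True
      thus ?thesis using a by auto
    next
      case False
      hence "\<bar>a\<bar> * \<bar>b\<bar> = a * b" using \<open>Y = 0\<close> assms by (auto simp: Y_def)
      thus ?thesis using a False assms by (auto simp: abs_if split: if_splits)
    qed
  next
    assume a: "a = r * b"
    hence "\<bar>a\<bar> = ?s" "\<bar>a\<bar> * \<bar>b\<bar> = a * b" using assms by (auto simp: abs_mult)
    thus "picone_term p r a b = 0" using X split by (simp add: Y_def)
  qed
qed

section \<open>Derivatives of powers and quotients, ordinary and conformable\<close>

text \<open>Away from zeros of \<open>U\<close> this is the chain rule. At a zero the difference
  quotient is U(t+h)/h times U(t+h)^(p-1), which tends to a * 0 because p > 1.\<close>

lemma has_real_derivative_powr_nonneg:
  fixes U :: "real \<Rightarrow> real"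
  assumes U: "(U has_real_derivative a) (at t)" and p: "1 < p"
    and nn: "eventually (\<lambda>s. 0 \<le> U s) (nhds t)"
  shows "((\<lambda>s. U s powr p) has_real_derivative p * U t powr (p - 1) * a) (at t)"
proof (cases "U t = 0")
  case False
  moreover have "0 \<le> U t" using nn by (rule eventually_nhds_x_imp_x)
  ultimately have "0 < U t" by simp
  thus ?thesis using U by (auto intro!: derivative_eq_intros)
next
  case True
  have lim: "((\<lambda>h. U (t + h) / h) \<longlongrightarrow> a) (at 0)"
    using U True by (simp add: DERIV_def)
  have "isCont U t" using U by (rule DERIV_isCont)
  hence "((\<lambda>h. U (t + h)) \<longlongrightarrow> 0) (at 0)"
    using True by (simp add: isCont_iff)
  moreover have nn': "eventually (\<lambda>h. 0 \<le> U (t + h)) (at 0)"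
    using nn eventually_at_to_0[of "\<lambda>s. 0 \<le> U s" t]
    by (auto simp: add.commute eventually_nhds_conv_at)
  ultimately have "((\<lambda>h. U (t + h) powr (p - 1)) \<longlongrightarrow> 0) (at 0)"
    using p by (intro tendsto_zero_powrI[where b = "p - 1"]) (auto intro: tendsto_const)
  from tendsto_mult[OF lim this]
  have "((\<lambda>h. U (t + h) / h * U (t + h) powr (p - 1)) \<longlongrightarrow> 0) (at 0)" by simp
  \<comment> \<open>Recombining the two powers relies on \<open>U\<close> being nonnegative near
    \<open>t\<close>.\<close>
  moreover have "eventually (\<lambda>h. U (t + h) / h * U (t + h) powr (p - 1) = U (t + h) powr p / h) (at 0)"
    using nn' by eventually_elim (auto simp: powr_mult_base)
  ultimately have "((\<lambda>h. U (t + h) powr p / h) \<longlongrightarrow> 0) (at 0)"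
    by (rule Lim_transform_eventually)
  thus ?thesis using True by (simp add: DERIV_def)
qed

text \<open>Product rule for U^p V^(1-p). The result is expressed through U/V, the form in which
  \<open>picone_term\<close> takes its argument \<open>r\<close>.\<close>

lemma has_real_derivative_powr_quotient:
  fixes U V :: "real \<Rightarrow> real"
  assumes U: "(U has_real_derivative a) (at t)" and V: "(V has_real_derivative b) (at t)"
    and p: "1 < p" and nn: "eventually (\<lambda>s. 0 \<le> U s) (nhds t)" and Vt: "0 < V t"
  shows "((\<lambda>s. U s powr p / V s powr (p - 1)) has_real_derivative
           p * (U t / V t) powr (p - 1) * a - (p - 1) * (U t / V t) powr p * b) (at t)"
proof -
  have "((\<lambda>s. V s powr (1 - p)) has_real_derivative (1 - p) * V t powr (- p) * b) (at t)"
    using V Vt by (auto intro!: derivative_eq_intros)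
  from DERIV_mult[OF has_real_derivative_powr_nonneg[OF U p nn] this]
  have "((\<lambda>s. U s powr p * V s powr (1 - p)) has_real_derivative
      p * U t powr (p - 1) * a * V t powr (1 - p) + (1 - p) * V t powr (- p) * b * U t powr p) (at t)" .
  moreover have "V s powr (1 - p) = inverse (V s powr (p - 1))" for s
    using powr_minus[of "V s" "p - 1"] by simp
  moreover have "(U t / V t) powr q = U t powr q * inverse (V t powr q)" for q
    unfolding powr_divide by (simp add: divide_inverse)
  ultimately show ?thesis
    by (simp add: powr_minus divide_inverse algebra_simps)
qed

text \<open>A positive weight allows the substitution of \<open>h * ?w\<close> for the increment.
  This is the converse passage to \<open>conf_pderiv_exists_imp_differentiable\<close>.\<close>

lemma conf_quotient_tendsto:
  fixes f :: "real^'n::finite \<Rightarrow> real"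
  assumes D: "((\<lambda>s. f (x + axis k s)) has_real_derivative D) (at 0)"
    and w: "0 < conf_weight \<alpha> (x $ k)"
  shows "(conf_quotient \<alpha> k f x \<longlongrightarrow> conf_weight \<alpha> (x $ k) * D) (at 0)"
proof -
  let ?w = "conf_weight \<alpha> (x $ k)"
  have [simp]: "axis k (0 :: real) = 0" by (simp add: axis_def vec_eq_iff)
  have lim0: "filterlim (\<lambda>h. h * ?w) (at 0) (at 0)"
    unfolding filterlim_at using w
    by (auto intro!: tendsto_eq_intros simp: eventually_at_filter)
  have "((\<lambda>h. (f (x + axis k h) - f x) / h) \<longlongrightarrow> D) (at 0)"
    using D by (simp add: DERIV_def)
  from tendsto_mult[OF tendsto_const filterlim_compose[OF this lim0], of ?w]
  have "((\<lambda>h. ?w * ((f (x + axis k (h * ?w)) - f x) / (h * ?w))) \<longlongrightarrow> ?w * D) (at 0)" .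
  moreover have "?w * ((f (x + axis k (h * ?w)) - f x) / (h * ?w)) = conf_quotient \<alpha> k f x h" for h
    using w by (simp add: conf_quotient_def)
  ultimately show ?thesis by (simp only:)
qed

lemma conf_pderiv_eq:
  fixes f :: "real^'n::finite \<Rightarrow> real"
  assumes "((\<lambda>s. f (x + axis k s)) has_real_derivative D) (at 0)" "0 < conf_weight \<alpha> (x $ k)"
  shows "conf_pderiv_exists \<alpha> k f x" "conf_pderiv \<alpha> k f x = conf_weight \<alpha> (x $ k) * D"
  using conf_quotient_tendsto[OF assms]
  by (auto simp: conf_pderiv_exists_def conf_pderiv_def intro: tendsto_Lim)

section \<open>The Picone identity at a point and the global statement\<close>

lemma picone_L_eq_sum:
  assumes "0 \<le> u x" "0 < v x"
  shows "picone_L \<alpha> p u v x =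
    (\<Sum>k\<in>UNIV. picone_term (p k) (u x / v x) (conf_pderiv \<alpha> k u x) (conf_pderiv \<alpha> k v x))"
  using assms unfolding picone_L_def picone_term_def
  by (simp add: powr_divide sum.distrib sum_subtractf)

lemma eventually_axis_in_open:
  fixes \<Omega> :: "(real^'n::finite) set"
  assumes "open \<Omega>" "x \<in> \<Omega>"
  shows "eventually (\<lambda>s. x + axis k s \<in> \<Omega>) (nhds 0)"
proof -
  have "((\<lambda>s. x + s *\<^sub>R axis k 1) \<longlongrightarrow> x) (nhds (0::real))"
    by (auto intro!: tendsto_eq_intros filterlim_ident)
  moreover have "(\<lambda>s. x + s *\<^sub>R axis k 1) = (\<lambda>s. x + axis k s)"
    by (simp add: axis_def vec_eq_iff fun_eq_iff)
  ultimately have "((\<lambda>s. x + axis k s) \<longlongrightarrow> x) (nhds (0::real))" by simp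
  thus ?thesis using assms by (rule topological_tendstoD)
qed

lemma picone_pointwise:
  fixes u v :: "real^'n::finite \<Rightarrow> real"
  assumes \<Omega>: "open \<Omega>" "x \<in> \<Omega>"
    and w: "\<And>k. 0 < conf_weight \<alpha> (x $ k)" and p: "\<And>k. 1 < p k"
    and u: "\<And>x. x \<in> \<Omega> \<Longrightarrow> 0 \<le> u x" and v: "\<And>x. x \<in> \<Omega> \<Longrightarrow> 0 < v x"
    and diff: "conf_differentiable_at \<alpha> u x" "conf_differentiable_at \<alpha> v x"
  shows "conf_pderiv_exists \<alpha> k (\<lambda>y. u y powr p k / v y powr (p k - 1)) x"
    and "picone_R \<alpha> p u v x = picone_L \<alpha> p u v x"
    and "0 \<le> picone_L \<alpha> p u v x"
    and "picone_L \<alpha> p u v x = 0 \<longleftrightarrow>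
      (\<forall>k. ((\<lambda>t. u (x + axis k t) / v (x + axis k t)) has_real_derivative 0) (at 0))"
proof -
  let ?w = "\<lambda>k. conf_weight \<alpha> (x $ k)" and ?r = "u x / v x"
  have axis0 [simp]: "axis k (0 :: real) = 0" for k :: 'n by (simp add: axis_def vec_eq_iff)
  have ux: "0 \<le> u x" and vx: "0 < v x" using u v \<Omega>(2) by auto
  have r: "0 \<le> ?r" using ux vx by simp
  have "\<exists>D. ((\<lambda>s. u (x + axis k s)) has_real_derivative D) (at 0)"
    and "\<exists>D. ((\<lambda>s. v (x + axis k s)) has_real_derivative D) (at 0)" for k
    using conf_pderiv_exists_imp_differentiable[of \<alpha> k _ x 0] diff w
    by (auto simp: conf_differentiable_at_def real_differentiable_def)
  \<comment> \<open>\<open>a\<close> and \<open>b\<close> are the ordinary partial derivatives; the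
    conformable ones are these times the weight.\<close>
  then obtain a b where
    a: "\<And>k. ((\<lambda>s. u (x + axis k s)) has_real_derivative a k) (at 0)" and
    b: "\<And>k. ((\<lambda>s. v (x + axis k s)) has_real_derivative b k) (at 0)"
    by metis
  have Du: "conf_pderiv \<alpha> k u x = ?w k * a k" and Dv: "conf_pderiv \<alpha> k v x = ?w k * b k" for k
    using conf_pderiv_eq[OF a w] conf_pderiv_eq[OF b w] by auto
  have nn: "eventually (\<lambda>s. 0 \<le> u (x + axis k s)) (nhds 0)" for k
    using eventually_axis_in_open[OF \<Omega>] by eventually_elim (rule u)
  have "((\<lambda>s. u (x + axis k s) powr p k / v (x + axis k s) powr (p k - 1)) has_real_derivative
      p k * ?r powr (p k - 1) * a k - (p k - 1) * ?r powr p k * b k) (at 0)" for k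
    using has_real_derivative_powr_quotient[OF a b p nn] vx by simp
  note Dq = conf_pderiv_eq[of "\<lambda>y. u y powr p k / v y powr (p k - 1)" for k, OF this w]
  show "conf_pderiv_exists \<alpha> k (\<lambda>y. u y powr p k / v y powr (p k - 1)) x" by (rule Dq(1))
  have L: "picone_L \<alpha> p u v x = (\<Sum>k\<in>UNIV. picone_term (p k) ?r (?w k * a k) (?w k * b k))"
    using picone_L_eq_sum[of u x v \<alpha> p, OF ux vx] by (simp add: Du Dv)
  have "picone_R \<alpha> p u v x = (\<Sum>k\<in>UNIV. picone_term (p k) ?r (?w k * a k) (?w k * b k))"
    unfolding picone_R_def sum_subtractf[symmetric]
  proof (rule sum.cong[OF refl])
    fix k
    let ?A = "?w k * a k" and ?B = "?w k * b k"
    \<comment> \<open>Expanding the derivative of the quotient gives the mixed term of L and a pure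
      term, whose factor |B|^(p-2) B B is |B|^p.\<close>
    have "(?w k * (p k * ?r powr (p k - 1) * a k - (p k - 1) * ?r powr p k * b k)) * (\<bar>?B\<bar> powr (p k - 2) * ?B)
      = p k * ?r powr (p k - 1) * \<bar>?B\<bar> powr (p k - 2) * ?A * ?B
        - (p k - 1) * ?r powr p k * (\<bar>?B\<bar> powr (p k - 2) * ?B * ?B)"
      by (simp add: algebra_simps)
    thus "\<bar>conf_pderiv \<alpha> k u x\<bar> powr p k
        - conf_pderiv \<alpha> k (\<lambda>y. u y powr p k / v y powr (p k - 1)) x
          * (\<bar>conf_pderiv \<alpha> k v x\<bar> powr (p k - 2) * conf_pderiv \<alpha> k v x)
      = picone_term (p k) ?r ?A ?B"
      unfolding Dq(2) Du Dv picone_term_def abs_powr_diff_two(2) by simp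
  qed
  thus "picone_R \<alpha> p u v x = picone_L \<alpha> p u v x" using L by simp
  show "0 \<le> picone_L \<alpha> p u v x"
    unfolding L by (intro sum_nonneg picone_term_nonneg p r)
  have deriv: "((\<lambda>t. u (x + axis k t) / v (x + axis k t)) has_real_derivative
      (a k - ?r * b k) / v x) (at 0)" for k
    using DERIV_divide[OF a b] vx by (simp add: field_simps)
  \<comment> \<open>A sum of nonnegative terms vanishes only termwise. Cancelling the positive
    weight leaves exactly the numerator in \<open>deriv\<close>.\<close>
  have "picone_L \<alpha> p u v x = 0 \<longleftrightarrow> (\<forall>k. ?w k * a k = ?r * (?w k * b k))"
    unfolding L by (subst sum_nonneg_eq_0_iff)
      (simp_all add: picone_term_nonneg picone_term_eq_0_iff p r)
  also have "\<dots> \<longleftrightarrow> (\<forall>k. (a k - ?r * b k) / v x = 0)"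
    using w vx by (auto simp: field_simps less_imp_neq[symmetric])
  also have "\<dots> \<longleftrightarrow> (\<forall>k. ((\<lambda>t. u (x + axis k t) / v (x + axis k t)) has_real_derivative 0) (at 0))"
    using deriv DERIV_unique by metis
  finally show "picone_L \<alpha> p u v x = 0 \<longleftrightarrow>
      (\<forall>k. ((\<lambda>t. u (x + axis k t) / v (x + axis k t)) has_real_derivative 0) (at 0))" .
qed

lemma luzin_along_axesD:
  assumes "luzin_along_axes f \<Omega>" "x \<in> \<Omega>"
  shows "luzin_on (\<lambda>t. f (x + axis k t)) {t. x + axis k t \<in> \<Omega>}"
  unfolding luzin_on_def using assms(1)[unfolded luzin_along_axes_def Let_def, rule_format, OF assms(2)] by simp

text \<open>The premises of the last conjunct guard the converse: a step function can have zero
  partial derivatives almost everywhere, and u = 0 makes L vanish with quotient 0, which is not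
  positive. \<open>luzin_along_axes_quotient\<close> supplies the Luzin premise when u and v are
  conformable differentiable throughout \<Omega>.\<close>

theorem proposition3p1:
  fixes \<alpha> :: real and p :: "'n::finite \<Rightarrow> real"
    and u v :: "real^'n \<Rightarrow> real" and \<Omega> :: "(real^'n) set"
  assumes "0 < \<alpha>" "\<alpha> \<le> 1"
    and "\<And>k. 1 < p k"
    and "open \<Omega>" "connected \<Omega>"
    and "\<alpha> < 1 \<longrightarrow> \<Omega> \<subseteq> {x. \<forall>k. 0 < x $ k}"
    and "\<And>x. x \<in> \<Omega> \<Longrightarrow> 0 \<le> u x"
    and "\<And>x. x \<in> \<Omega> \<Longrightarrow> 0 < v x"
    and "AE x\<in>\<Omega> in lebesgue. conf_differentiable_at \<alpha> u x"
    and "AE x\<in>\<Omega> in lebesgue. conf_differentiable_at \<alpha> v x"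
  shows "(AE x\<in>\<Omega> in lebesgue.
            (\<forall>k. conf_pderiv_exists \<alpha> k (\<lambda>y. u y powr p k / v y powr (p k - 1)) x)
            \<and> picone_R \<alpha> p u v x = picone_L \<alpha> p u v x \<and> 0 \<le> picone_L \<alpha> p u v x)
       \<and> ((\<exists>c>0. \<forall>x\<in>\<Omega>. u x / v x = c) \<longrightarrow> (AE x\<in>\<Omega> in lebesgue. picone_L \<alpha> p u v x = 0))
       \<and> (luzin_along_axes (\<lambda>x. u x / v x) \<Omega> \<and> (\<exists>x\<in>\<Omega>. u x \<noteq> 0) \<longrightarrow>
            ((AE x\<in>\<Omega> in lebesgue. picone_L \<alpha> p u v x = 0) \<longleftrightarrow> (\<exists>c>0. \<forall>x\<in>\<Omega>. u x / v x = c)))"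
proof -
  have w: "0 < conf_weight \<alpha> (x $ k)" if "x \<in> \<Omega>" for x k
    using that assms(2,6) by (intro conf_weight_pos) blast+
  let ?flat = "\<lambda>x. \<forall>k. ((\<lambda>t. u (x + axis k t) / v (x + axis k t)) has_real_derivative 0) (at 0)"
  have diff: "AE x in lebesgue. x \<in> \<Omega> \<longrightarrow>
      conf_differentiable_at \<alpha> u x \<and> conf_differentiable_at \<alpha> v x"
    using assms(9,10) by eventually_elim blast
  have pointwise: "AE x in lebesgue. x \<in> \<Omega> \<longrightarrow>
      ((\<forall>k. conf_pderiv_exists \<alpha> k (\<lambda>y. u y powr p k / v y powr (p k - 1)) x)
        \<and> picone_R \<alpha> p u v x = picone_L \<alpha> p u v x \<and> 0 \<le> picone_L \<alpha> p u v x)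
      \<and> (picone_L \<alpha> p u v x = 0 \<longleftrightarrow> ?flat x)"
    using diff
  proof eventually_elim
    case (elim x)
    show ?case
    proof (intro impI)
      assume x: "x \<in> \<Omega>"
      hence "conf_differentiable_at \<alpha> u x" "conf_differentiable_at \<alpha> v x" using elim by auto
      note * = picone_pointwise[of \<Omega> x \<alpha> p u v, OF assms(4) x w[OF x] assms(3,7,8) this]
      show "((\<forall>k. conf_pderiv_exists \<alpha> k (\<lambda>y. u y powr p k / v y powr (p k - 1)) x)
          \<and> picone_R \<alpha> p u v x = picone_L \<alpha> p u v x \<and> 0 \<le> picone_L \<alpha> p u v x)
        \<and> (picone_L \<alpha> p u v x = 0 \<longleftrightarrow> ?flat x)"
        by (intro conjI allI *)
    qed
  qed
  have part1: "AE x\<in>\<Omega> in lebesgue.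
      (\<forall>k. conf_pderiv_exists \<alpha> k (\<lambda>y. u y powr p k / v y powr (p k - 1)) x)
      \<and> picone_R \<alpha> p u v x = picone_L \<alpha> p u v x \<and> 0 \<le> picone_L \<alpha> p u v x"
    using pointwise by eventually_elim blast
  have part2: "AE x\<in>\<Omega> in lebesgue. picone_L \<alpha> p u v x = 0" if "\<forall>x\<in>\<Omega>. u x / v x = c" for c
    using pointwise
  proof eventually_elim
    case (elim x)
    show ?case
    proof
      assume x: "x \<in> \<Omega>"
      have "?flat x"
      proof
        fix k
        \<comment> \<open>The quotient is known to equal \<open>c\<close> only inside \<Omega>, so
          openness is used to compare it with a constant near 0.\<close>
        have "eventually (\<lambda>t. u (x + axis k t) / v (x + axis k t) = c) (nhds 0)"
          using eventually_axis_in_open[OF assms(4) x] by eventually_elim (use that in blast)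
        moreover have "((\<lambda>_. c) has_real_derivative 0) (at 0)" by (rule DERIV_const)
        ultimately show "((\<lambda>t. u (x + axis k t) / v (x + axis k t)) has_real_derivative 0) (at 0)"
          by (subst DERIV_cong_ev[OF refl _ refl])
      qed
      thus "picone_L \<alpha> p u v x = 0" using elim x by blast
    qed
  qed
  have part3: "\<exists>c>0. \<forall>x\<in>\<Omega>. u x / v x = c"
    if luzin: "luzin_along_axes (\<lambda>x. u x / v x) \<Omega>" and x0: "x0 \<in> \<Omega>" "u x0 \<noteq> 0"
      and zero: "AE x\<in>\<Omega> in lebesgue. picone_L \<alpha> p u v x = 0" for x0
  proof -
    have axis: "t *\<^sub>R axis k 1 = axis k t" for t :: real and k :: 'n
      by (simp add: axis_def vec_eq_iff)
    have Basis: "(\<forall>b\<in>Basis. Q b) \<longleftrightarrow> (\<forall>k. Q (axis k 1))" for Q :: "real^'n \<Rightarrow> bool"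
      by (auto simp: Basis_vec_def)
    have "\<forall>b\<in>Basis. luzin_on (\<lambda>t. u (x + t *\<^sub>R b) / v (x + t *\<^sub>R b)) {t. x + t *\<^sub>R b \<in> \<Omega>}"
      if "x \<in> \<Omega>" for x
      unfolding Basis axis using luzin_along_axesD[OF luzin that] by blast
    moreover have "AE x in lborel. x \<in> \<Omega> \<longrightarrow>
        (\<forall>b\<in>Basis. ((\<lambda>t. u (x + t *\<^sub>R b) / v (x + t *\<^sub>R b)) has_real_derivative 0) (at 0))"
      unfolding Basis axis
      \<comment> \<open>Lebesgue measure is the completion of \<open>lborel\<close>, where the
        Fubini argument was carried out.\<close>
      using pointwise[unfolded AE_completion_iff] zero[unfolded AE_completion_iff]
      by eventually_elim blast
    ultimately have "u x / v x = u x0 / v x0" if "x \<in> \<Omega>" for x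
      by (intro luzin_constant_open_connected[of \<Omega> "\<lambda>x. u x / v x" x x0])
         (use assms(4,5) that x0(1) in auto)
    \<comment> \<open>The point where u is nonzero makes the constant strictly positive.\<close>
    moreover have "0 < u x0 / v x0"
      using assms(7,8)[OF x0(1)] x0(2) by simp
    ultimately show ?thesis by blast
  qed
  show ?thesis
    using part1 part2 part3 by blast
qed

end
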